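(* Let $\Omega\subseteq\mathbb{R}^n$ be open and let $u:\Omega\to\mathbb{R}$ be a finite valued Baire-1 function (in particular, $u$ may be any finite valued semicontinuous function). Then the sets $$E_1:=\{x\in\Omega:\ \nabla u(x)\text{ exists finitely and }\nabla u(x)=0\}$$ and $$E_2:=\{x\in\Omega:\ \nabla u(x)\text{ does not exist finitely}\}$$ are Borel sets (both can be empty).
   Context: A Baire-1 function is a pointwise limit of a sequence of continuous real valued functions. "$\nabla u(x)$ exists finitely" means that all the first order partial derivatives of $u$ at $x$ exist as finite limits of difference quotients (no differentiability of $u$ at $x$ is required), and $\nabla u(x)$ is then the vector of these partial derivatives. Thus $E_2$ is the set of points at which some partial derivative equals $\pm\infty$ or the limit defining it does not exist. *)

theory Defs
  imports "HOL-Analysis.Analysis"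
begin

(* Functions on an open set S are represented by total functions, of which only the
   restriction to S matters: the difference quotients below are eventually formed
   from values on S when x lies in the open set S. *)

definition baire_one_on :: "'a::topological_space set \<Rightarrow> ('a \<Rightarrow> real) \<Rightarrow> bool" where
  "baire_one_on S u \<longleftrightarrow>
     (\<exists>f :: nat \<Rightarrow> 'a \<Rightarrow> real.
        (\<forall>k. continuous_on S (f k)) \<and> (\<forall>x\<in>S. (\<lambda>k. f k x) \<longlonglongrightarrow> u x))"

definition lower_semicontinuous_on :: "'a::topological_space set \<Rightarrow> ('a \<Rightarrow> real) \<Rightarrow> bool" where
  "lower_semicontinuous_on S u \<longleftrightarrow>
     (\<forall>x\<in>S. \<forall>c<u x. eventually (\<lambda>y. c < u y) (at x within S))"

definition upper_semicontinuous_on :: "'a::topological_space set \<Rightarrow> ('a \<Rightarrow> real) \<Rightarrow> bool" where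
  "upper_semicontinuous_on S u \<longleftrightarrow>
     (\<forall>x\<in>S. \<forall>c>u x. eventually (\<lambda>y. u y < c) (at x within S))"

definition partial_quotient :: "(real ^ 'n \<Rightarrow> real) \<Rightarrow> 'n \<Rightarrow> real ^ 'n \<Rightarrow> real \<Rightarrow> real" where
  "partial_quotient u i x h = (u (x + h *\<^sub>R axis i 1) - u x) / h"

(* The limits are required to be real, so infinite partial derivatives are excluded;
   differentiability of u at x is not required. *)
definition grad_exists :: "(real ^ 'n \<Rightarrow> real) \<Rightarrow> real ^ 'n \<Rightarrow> bool" where
  "grad_exists u x \<longleftrightarrow> (\<forall>i. \<exists>d :: real. (partial_quotient u i x \<longlongrightarrow> d) (at 0))"

(* Only meaningful where grad_exists u x holds. *)
definition grad :: "(real ^ 'n \<Rightarrow> real) \<Rightarrow> real ^ 'n \<Rightarrow> real ^ 'n" where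
  "grad u x = (\<chi> i. Lim (at 0) (partial_quotient u i x))"

definition zero_grad_set :: "(real ^ 'n) set \<Rightarrow> (real ^ 'n \<Rightarrow> real) \<Rightarrow> (real ^ 'n) set" where
  "zero_grad_set S u = {x \<in> S. grad_exists u x \<and> grad u x = 0}"

definition no_grad_set :: "(real ^ 'n) set \<Rightarrow> (real ^ 'n \<Rightarrow> real) \<Rightarrow> (real ^ 'n) set" where
  "no_grad_set S u = {x \<in> S. \<not> grad_exists u x}"

end

(* If u is a pointwise limit of continuous functions, then so is the difference quotient, as a
   function of (x, h), on the open set of all (x, h) with h \<noteq> 0 and both x and x + h e\<^sub>i in \<Omega>.
   Hence its strict superlevel sets are countable unions of compact sets, and so are their
   projections to the x-space. This makes the existential quantifier over the uncountably
   many h harmless, and the remaining quantifiers in the definition of the limit can be taken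
   to range over countable sets.

   Semicontinuous functions are reduced to bounded ones by arctan and are then approximated by
   the Lipschitz envelopes inf\<^sub>y (v y + k d(x, y)). *)

theory Submission
  imports Defs
begin

section \<open>Baire-1 functions, their superlevel sets and projections\<close>

lemma baire_one_onE:
  assumes "baire_one_on S u"
  obtains f :: "nat \<Rightarrow> 'a::topological_space \<Rightarrow> real"
  where "\<And>k. continuous_on S (f k)" "\<And>x. x \<in> S \<Longrightarrow> (\<lambda>k. f k x) \<longlonglongrightarrow> u x"
  using assms that unfolding baire_one_on_def by blast

lemma continuous_on_imp_baire_one_on:
  "continuous_on S u \<Longrightarrow> baire_one_on S u"
  unfolding baire_one_on_def by (rule exI[of _ "\<lambda>_. u"]) simp

lemma baire_one_on_minus:
  assumes "baire_one_on S u"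
  shows "baire_one_on S (\<lambda>x. - u x)"
proof -
  from assms obtain f where f: "\<And>k. continuous_on S (f k)" "\<And>x. x \<in> S \<Longrightarrow> (\<lambda>k. f k x) \<longlonglongrightarrow> u x"
    by (rule baire_one_onE) blast
  show ?thesis
    unfolding baire_one_on_def
    by (rule exI[of _ "\<lambda>k x. - f k x"]) (auto intro!: continuous_intros tendsto_intros f)
qed

text \<open>The limit exceeds \<open>c\<close> exactly when some margin 1/(j+1) and some N give
  \<open>c + 1 / real (Suc j) \<le> f k p\<close> for all k \<ge> N. For fixed j and N this
  condition is relatively closed, and a compact exhaustion of \<open>W\<close> cuts it into compact
  pieces.\<close>

lemma baire_one_on_superlevel_sigma_compact:
  fixes W :: "'a::euclidean_space set"
  assumes "open W" "baire_one_on W g"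
  obtains \<C> where "countable \<C>" "\<And>C. C \<in> \<C> \<Longrightarrow> compact C" "{p \<in> W. c < g p} = \<Union>\<C>"
proof -
  from assms(2) obtain f where f: "\<And>k. continuous_on W (f k)" "\<And>x. x \<in> W \<Longrightarrow> (\<lambda>k. f k x) \<longlonglongrightarrow> g x"
    by (rule baire_one_onE) blast
  obtain K :: "nat \<Rightarrow> 'a set" where K: "\<And>n. compact (K n)" "\<And>n. K n \<subseteq> W" "(\<Union>n. K n) = W"
    using open_Union_compact_subsets[OF assms(1)] by metis
  define C where "C = (\<lambda>(m, j, N). \<Inter>k\<in>{N..}. {p \<in> K m. c + 1 / real (Suc j) \<le> f k p})"
  have "compact (C i)" for i
  proof -
    obtain m j N where i: "i = (m, j, N)" by (cases i)
    have "closed {p \<in> K m. c + 1 / real (Suc j) \<le> f k p}" for k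
    proof -
      have "closed (K m \<inter> f k -` {c + 1 / real (Suc j)..})"
        by (intro continuous_closed_preimage continuous_on_subset[OF f(1) K(2)]
            compact_imp_closed K(1) closed_atLeast)
      also have "K m \<inter> f k -` {c + 1 / real (Suc j)..} = {p \<in> K m. c + 1 / real (Suc j) \<le> f k p}"
        by auto
      finally show ?thesis .
    qed
    then have "closed (C i)"
      unfolding i C_def by auto
    moreover have "C i \<subseteq> K m"
      unfolding i C_def by auto
    ultimately show ?thesis
      using compact_Int_closed[OF K(1), of "C i" m] by (simp add: Int_absorb1)
  qed
  moreover have "{p \<in> W. c < g p} = (\<Union>i. C i)"
  proof (intro equalityI subsetI)
    fix p assume "p \<in> {p \<in> W. c < g p}"
    then have p: "p \<in> W" "c < g p" by auto
    obtain j where j: "1 / real (Suc j) < g p - c"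
      using nat_approx_posE[of "g p - c"] p(2) by auto
    have "eventually (\<lambda>k. c + 1 / real (Suc j) < f k p) sequentially"
      using order_tendstoD(1)[OF f(2)[OF p(1)]] j by (simp add: algebra_simps)
    then obtain N where "\<And>k. k \<ge> N \<Longrightarrow> c + 1 / real (Suc j) < f k p"
      unfolding eventually_sequentially by blast
    moreover obtain m where "p \<in> K m" using p(1) K(3) by blast
    ultimately have "p \<in> C (m, j, N)" unfolding C_def by (auto intro: less_imp_le)
    then show "p \<in> (\<Union>i. C i)" by blast
  next
    fix p assume "p \<in> (\<Union>i. C i)"
    then obtain m j N where *: "p \<in> C (m, j, N)" by auto
    then have "p \<in> K m" unfolding C_def by auto
    then have W: "p \<in> W" using K(2) by blast
    \<comment> \<open>Limits preserve only weak inequalities; the margin restores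
      strictness.\<close>
    have "c + 1 / real (Suc j) \<le> g p"
      by (rule tendsto_lowerbound[OF f(2)[OF W]])
         (use * in \<open>auto simp: C_def eventually_sequentially\<close>)
    moreover have "0 < 1 / real (Suc j)" by simp
    ultimately have "c < g p" by linarith
    then show "p \<in> {p \<in> W. c < g p}" using W by simp
  qed
  ultimately show thesis
    using that[of "range C"] by blast
qed

text \<open>Projections of Borel sets need not be Borel, but continuous images of compact sets are
  compact, so sigma-compactness survives the projection.\<close>

lemma borel_fst_image_superlevel:
  fixes W :: "('a::euclidean_space \<times> 'b::euclidean_space) set"
  assumes "open W" "baire_one_on W g"
  shows "fst ` {p \<in> W. c < g p} \<in> sets borel"
proof -
  obtain \<C> where \<C>: "countable \<C>" "\<And>C. C \<in> \<C> \<Longrightarrow> compact C" "{p \<in> W. c < g p} = \<Union>\<C>"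
    by (rule baire_one_on_superlevel_sigma_compact[OF assms, of c]) blast
  have "compact (fst ` C)" if "C \<in> \<C>" for C
    by (intro compact_continuous_image continuous_intros \<C>(2) that)
  then have "(\<Union>C\<in>\<C>. fst ` C) \<in> sets borel"
    by (intro sets.countable_UN' \<C>(1)) (auto intro: borel_compact)
  then show ?thesis
    by (simp add: \<C>(3) image_Union)
qed

section \<open>Difference quotients as functions of (x, h)\<close>

definition quotient_domain :: "(real ^ 'n) set \<Rightarrow> 'n \<Rightarrow> real \<Rightarrow> ((real ^ 'n) \<times> real) set" where
  "quotient_domain S i \<delta> = {(x, h). x \<in> S \<and> x + h *\<^sub>R axis i 1 \<in> S \<and> h \<noteq> 0 \<and> \<bar>h\<bar> < \<delta>}"

lemma open_quotient_domain:
  assumes "open S"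
  shows "open (quotient_domain S i \<delta>)"
proof -
  have "quotient_domain S i \<delta> =
      fst -` S \<inter> (\<lambda>p. fst p + snd p *\<^sub>R axis i 1) -` S \<inter> snd -` ({- \<delta><..<\<delta>} - {0})"
    unfolding quotient_domain_def by (auto simp: abs_if split: if_splits)
  also have "open \<dots>"
    by (intro open_Int open_vimage open_Diff continuous_intros assms)
  finally show ?thesis .
qed

text \<open>The quotients of the approximants of \<open>u\<close> converge pointwise, and they are
  continuous because the domain keeps both evaluation points in \<open>S\<close> and h away from
  0.\<close>

lemma baire_one_on_partial_quotient:
  assumes "baire_one_on S u"
  shows "baire_one_on (quotient_domain S i \<delta>) (\<lambda>p. \<bar>partial_quotient u i (fst p) (snd p) - q\<bar>)"
proof -
  from assms obtain f where f: "\<And>k. continuous_on S (f k)" "\<And>x. x \<in> S \<Longrightarrow> (\<lambda>k. f k x) \<longlonglongrightarrow> u x"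
    by (rule baire_one_onE) blast
  let ?D = "quotient_domain S i \<delta>"
  let ?g = "\<lambda>k p. \<bar>partial_quotient (f k) i (fst p) (snd p) - q\<bar>"
  have "continuous_on ?D (?g k)" for k
    unfolding partial_quotient_def
    by (intro continuous_intros continuous_on_compose2[OF f(1)]) (auto simp: quotient_domain_def)
  moreover have "(\<lambda>k. ?g k p) \<longlonglongrightarrow> \<bar>partial_quotient u i (fst p) (snd p) - q\<bar>" if "p \<in> ?D" for p
    unfolding partial_quotient_def
    by (intro tendsto_intros f(2)) (use that in \<open>auto simp: quotient_domain_def\<close>)
  ultimately show ?thesis
    unfolding baire_one_on_def by (intro exI[of _ ?g]) simp
qed

text \<open>The weak bound makes its failure at a given h a strict superlevel condition, the form to
  which the projection lemma applies.\<close>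

definition quotients_near :: "(real ^ 'n) set \<Rightarrow> (real ^ 'n \<Rightarrow> real) \<Rightarrow> 'n \<Rightarrow> real \<Rightarrow> real \<Rightarrow> (real ^ 'n) set" where
  "quotients_near S u i q \<epsilon> =
     {x \<in> S. eventually (\<lambda>h. \<bar>partial_quotient u i x h - q\<bar> \<le> \<epsilon>) (at 0)}"

text \<open>The radius in "eventually" may be taken of the form 1/(m+1); for fixed m, a bound for
  all h is the complement of a projection.\<close>

lemma quotients_near_conv:
  fixes S :: "(real ^ 'n) set"
  assumes "open S"
  shows "quotients_near S u i q \<epsilon> =
    (\<Union>m. S - fst ` {p \<in> quotient_domain S i (1 / real (Suc m)).
             \<epsilon> < \<bar>partial_quotient u i (fst p) (snd p) - q\<bar>})"
    (is "_ = (\<Union>m. S - fst ` ?B m)")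
proof (intro equalityI subsetI)
  fix x assume "x \<in> quotients_near S u i q \<epsilon>"
  then obtain d where d: "x \<in> S" "d > 0" "\<And>h. h \<noteq> 0 \<Longrightarrow> \<bar>h\<bar> < d \<Longrightarrow> \<bar>partial_quotient u i x h - q\<bar> \<le> \<epsilon>"
    unfolding quotients_near_def eventually_at by auto
  obtain m where "1 / real (Suc m) < d" using nat_approx_posE[OF d(2)] by blast
  then have "\<not> \<epsilon> < \<bar>partial_quotient u i x h - q\<bar>" if "(x, h) \<in> quotient_domain S i (1 / real (Suc m))" for h
    using d(3)[of h] that unfolding quotient_domain_def by (simp del: of_nat_Suc)
  then have "x \<notin> fst ` ?B m"
    by auto
  then show "x \<in> (\<Union>m. S - fst ` ?B m)" using d(1) by blast
next
  fix x assume "x \<in> (\<Union>m. S - fst ` ?B m)"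
  then obtain m where m: "x \<in> S" "x \<notin> fst ` ?B m" by blast
  \<comment> \<open>Since \<open>S\<close> is open, the shifted point stays in \<open>S\<close> for
    small h, so the domain constraint excludes no h close to 0.\<close>
  have "((\<lambda>h. x + h *\<^sub>R axis i 1) \<longlongrightarrow> x + 0 *\<^sub>R axis i 1) (at (0::real))"
    by (intro tendsto_intros)
  then have "eventually (\<lambda>h::real. x + h *\<^sub>R axis i 1 \<in> S) (at 0)"
    using assms m(1) by (simp add: topological_tendstoD)
  moreover have "eventually (\<lambda>h::real. h \<noteq> 0 \<and> \<bar>h\<bar> < 1 / real (Suc m)) (at 0)"
    unfolding eventually_at by (rule exI[of _ "1 / real (Suc m)"]) auto
  ultimately have "eventually (\<lambda>h. \<bar>partial_quotient u i x h - q\<bar> \<le> \<epsilon>) (at 0)"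
  proof eventually_elim
    case (elim h)
    then have "(x, h) \<in> quotient_domain S i (1 / real (Suc m))"
      using m(1) by (simp add: quotient_domain_def)
    moreover have "(x, h) \<notin> ?B m"
    proof
      assume "(x, h) \<in> ?B m"
      then have "fst (x, h) \<in> fst ` ?B m" by (rule imageI)
      with m(2) show False unfolding fst_conv by contradiction
    qed
    ultimately show ?case by simp
  qed
  then show "x \<in> quotients_near S u i q \<epsilon>"
    using m(1) by (simp add: quotients_near_def)
qed

lemma borel_quotients_near:
  assumes "open S" "baire_one_on S u"
  shows "quotients_near S u i q \<epsilon> \<in> sets borel"
  unfolding quotients_near_conv[OF assms(1)]
  by (intro sets.countable_UN'' sets.Diff borel_open assms countableI_type
      borel_fst_image_superlevel open_quotient_domain baire_one_on_partial_quotient)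

section \<open>Convergence expressed with countable quantifiers\<close>

lemma tendsto_real_iff_eventually_dist_Suc:
  fixes f :: "'a \<Rightarrow> real"
  shows "(f \<longlongrightarrow> l) F \<longleftrightarrow> (\<forall>n. eventually (\<lambda>h. \<bar>f h - l\<bar> \<le> 1 / real (Suc n)) F)"
proof
  assume lim: "(f \<longlongrightarrow> l) F"
  show "\<forall>n. eventually (\<lambda>h. \<bar>f h - l\<bar> \<le> 1 / real (Suc n)) F"
  proof
    fix n
    have "eventually (\<lambda>h. dist (f h) l < 1 / real (Suc n)) F"
      using lim by (rule tendstoD) simp
    then show "eventually (\<lambda>h. \<bar>f h - l\<bar> \<le> 1 / real (Suc n)) F"
      by eventually_elim (simp add: dist_real_def)
  qed
next
  assume *: "\<forall>n. eventually (\<lambda>h. \<bar>f h - l\<bar> \<le> 1 / real (Suc n)) F"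
  show "(f \<longlongrightarrow> l) F"
  proof (rule tendstoI)
    fix e :: real assume "0 < e"
    then obtain n where n: "1 / real (Suc n) < e" using nat_approx_posE by blast
    from * have "eventually (\<lambda>h. \<bar>f h - l\<bar> \<le> 1 / real (Suc n)) F" by blast
    then show "eventually (\<lambda>h. dist (f h) l < e) F"
      by (rule eventually_mono) (use n in \<open>auto simp: dist_real_def\<close>)
  qed
qed

text \<open>A Cauchy criterion: rational approximations, one for each precision, replace the
  quantifier over the uncountably many candidate limits. Completeness supplies the limit.\<close>

lemma convergent_real_iff_eventually_near_rational:
  fixes f :: "'a \<Rightarrow> real"
  assumes "F \<noteq> bot"
  shows "(\<exists>l. (f \<longlongrightarrow> l) F) \<longleftrightarrow> (\<forall>n. \<exists>q\<in>\<rat>. eventually (\<lambda>h. \<bar>f h - q\<bar> \<le> 1 / real (Suc n)) F)"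
proof
  assume "\<exists>l. (f \<longlongrightarrow> l) F"
  then obtain l where l: "(f \<longlongrightarrow> l) F" ..
  show "\<forall>n. \<exists>q\<in>\<rat>. eventually (\<lambda>h. \<bar>f h - q\<bar> \<le> 1 / real (Suc n)) F"
  proof
    fix n
    \<comment> \<open>Placing q strictly above l, within 1/(n+1), puts l inside the open interval
      from q - 1/(n+1) to q, which then eventually contains f h.\<close>
    obtain q where q: "q \<in> \<rat>" "l < q" "q < l + 1 / real (Suc n)"
      using Rats_dense_in_real[of l "l + 1 / real (Suc n)"] by auto
    have "q - 1 / real (Suc n) < l" using q(3) by linarith
    then have "eventually (\<lambda>h. q - 1 / real (Suc n) < f h) F" "eventually (\<lambda>h. f h < q) F"
      using order_tendstoD[OF l] q(2) by blast+
    then have "eventually (\<lambda>h. \<bar>f h - q\<bar> \<le> 1 / real (Suc n)) F"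
      by eventually_elim auto
    with q(1) show "\<exists>q\<in>\<rat>. eventually (\<lambda>h. \<bar>f h - q\<bar> \<le> 1 / real (Suc n)) F" by blast
  qed
next
  assume R: "\<forall>n. \<exists>q\<in>\<rat>. eventually (\<lambda>h. \<bar>f h - q\<bar> \<le> 1 / real (Suc n)) F"
  then obtain q where q: "\<And>n. eventually (\<lambda>h. \<bar>f h - q n\<bar> \<le> 1 / real (Suc n)) F"
    by metis
  \<comment> \<open>Both estimates hold at a common point because \<open>F\<close> is
    nontrivial.\<close>
  have near: "\<bar>q m - q n\<bar> \<le> 1 / real (Suc m) + 1 / real (Suc n)" for m n
  proof -
    from q[of m] q[of n] have "eventually (\<lambda>h. \<bar>q m - q n\<bar> \<le> 1 / real (Suc m) + 1 / real (Suc n)) F"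
      by eventually_elim linarith
    then show ?thesis using assms by (simp add: eventually_const_iff)
  qed
  have "Cauchy q"
  proof (rule metric_CauchyI)
    fix e :: real assume "0 < e"
    then obtain N where N: "1 / real (Suc N) < e / 2" using nat_approx_posE[of "e / 2"] by auto
    have "dist (q m) (q n) < e" if "m \<ge> N" "n \<ge> N" for m n
    proof -
      have "1 / real (Suc m) \<le> 1 / real (Suc N)" "1 / real (Suc n) \<le> 1 / real (Suc N)"
        using that by (auto simp: field_simps)
      then show ?thesis using near[of m n] N by (simp add: dist_real_def)
    qed
    then show "\<exists>M. \<forall>m\<ge>M. \<forall>n\<ge>M. dist (q m) (q n) < e" by blast
  qed
  then obtain l where l: "q \<longlonglongrightarrow> l"
    using Cauchy_convergent convergent_def by blast
  \<comment> \<open>This is \<open>near\<close> with n tending to infinity.\<close>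
  have ql: "\<bar>q m - l\<bar> \<le> 1 / real (Suc m)" for m
  proof (rule tendsto_le[OF sequentially_bot])
    show "(\<lambda>n. \<bar>q m - q n\<bar>) \<longlonglongrightarrow> \<bar>q m - l\<bar>" by (intro tendsto_intros l)
    show "(\<lambda>n. 1 / real (Suc m) + 1 / real (Suc n)) \<longlonglongrightarrow> 1 / real (Suc m)"
      using tendsto_add[OF tendsto_const LIMSEQ_inverse_real_of_nat, of "1 / real (Suc m)"]
      by (simp add: inverse_eq_divide)
    show "eventually (\<lambda>n. \<bar>q m - q n\<bar> \<le> 1 / real (Suc m) + 1 / real (Suc n)) sequentially"
      using near by simp
  qed
  have "(f \<longlongrightarrow> l) F"
  proof (rule tendstoI)
    fix e :: real assume "0 < e"
    then obtain N where N: "1 / real (Suc N) < e / 2" using nat_approx_posE[of "e / 2"] by auto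
    from q[of N] show "eventually (\<lambda>h. dist (f h) l < e) F"
      by eventually_elim (use ql[of N] N in \<open>simp add: dist_real_def\<close>)
  qed
  then show "\<exists>l. (f \<longlongrightarrow> l) F" ..
qed

section \<open>Borel measurability of the two gradient sets\<close>

lemma zero_grad_set_conv:
  "zero_grad_set S u = S \<inter> (\<Inter>i. \<Inter>n. quotients_near S u i 0 (1 / real (Suc n)))"
proof -
  have "grad_exists u x \<and> grad u x = 0 \<longleftrightarrow> (\<forall>i. (partial_quotient u i x \<longlongrightarrow> 0) (at 0))" for x
    unfolding grad_exists_def grad_def vec_eq_iff
    \<comment> \<open>Uniqueness of limits at 0 identifies each existing limit with the
      \<open>Lim\<close> in \<open>grad\<close>.\<close>
    by (auto, metis tendsto_Lim trivial_limit_at, metis tendsto_Lim trivial_limit_at)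
  then show ?thesis
    unfolding zero_grad_set_def quotients_near_def
    using tendsto_real_iff_eventually_dist_Suc[of "partial_quotient u _ _" 0] by auto
qed

text \<open>The derivative is not known in advance, hence the union over rational q, chosen anew for
  each n. The index i ranges over a finite type, so all operations are countable.\<close>

lemma no_grad_set_conv:
  "no_grad_set S u = S - (\<Inter>i. \<Inter>n. \<Union>q\<in>\<rat>. quotients_near S u i q (1 / real (Suc n)))"
  unfolding no_grad_set_def quotients_near_def grad_exists_def
  by (auto simp: convergent_real_iff_eventually_near_rational)

lemma borel_zero_grad_set:
  assumes "open S" "baire_one_on S u"
  shows "zero_grad_set S u \<in> sets borel"
  unfolding zero_grad_set_conv
  using assms
  by (intro sets.Int sets.countable_INT'' borel_quotients_near borel_open) auto

lemma borel_no_grad_set: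
  assumes "open S" "baire_one_on S u"
  shows "no_grad_set S u \<in> sets borel"
  unfolding no_grad_set_conv
  using assms
  by (intro sets.Diff sets.countable_INT'' sets.countable_UN'' borel_quotients_near borel_open countable_rat) auto

section \<open>Semicontinuous functions are Baire-1\<close>

definition lipschitz_envelope :: "'a::metric_space set \<Rightarrow> ('a \<Rightarrow> real) \<Rightarrow> real \<Rightarrow> 'a \<Rightarrow> real" where
  "lipschitz_envelope S v k x = (INF y\<in>S. v y + k * dist x y)"

context
  fixes S :: "'a::metric_space set" and v :: "'a \<Rightarrow> real" and b :: real
  assumes lower: "\<And>y. y \<in> S \<Longrightarrow> b \<le> v y"
begin

lemma lipschitz_envelope_le:
  assumes "y \<in> S" "k \<ge> 0"
  shows "lipschitz_envelope S v k x \<le> v y + k * dist x y"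
  unfolding lipschitz_envelope_def
proof (rule cINF_lower[OF _ assms(1)])
  show "bdd_below ((\<lambda>y. v y + k * dist x y) ` S)"
    using lower assms(2) by (intro bdd_belowI2[of _ b]) (meson add_increasing2 mult_nonneg_nonneg zero_le_dist)
qed

text \<open>By the triangle inequality, an infimum of k-Lipschitz functions is k-Lipschitz;
  exchanging x and y turns the one-sided estimate into a two-sided one.\<close>

lemma continuous_on_lipschitz_envelope:
  assumes "S \<noteq> {}" "k \<ge> 0"
  shows "continuous_on T (lipschitz_envelope S v k)"
proof -
  have *: "lipschitz_envelope S v k x - k * dist x y \<le> lipschitz_envelope S v k y" for x y
    unfolding lipschitz_envelope_def[of S v k y]
  proof (rule cINF_greatest[OF assms(1)])
    fix z assume "z \<in> S"
    then have "lipschitz_envelope S v k x \<le> v z + k * dist x z"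
      using lipschitz_envelope_le assms(2) by blast
    also have "\<dots> \<le> v z + k * (dist x y + dist y z)"
      using dist_triangle assms(2) by (intro add_left_mono mult_left_mono)
    finally show "lipschitz_envelope S v k x - k * dist x y \<le> v z + k * dist y z"
      by (simp add: algebra_simps)
  qed
  have "k-lipschitz_on T (lipschitz_envelope S v k)"
  proof (rule lipschitz_onI)
    fix x y
    show "dist (lipschitz_envelope S v k x) (lipschitz_envelope S v k y) \<le> k * dist x y"
      using *[of x y] *[of y x] by (simp add: dist_real_def dist_commute abs_le_iff)
  qed (use assms in auto)
  then show ?thesis by (rule lipschitz_on_continuous_on)
qed

text \<open>Taking y = x bounds the envelope above by v x. For the lower bound, semicontinuity
  controls the y near x, while for distant y the penalty k d(x, y) outweighs the gap down to
  \<open>b\<close>.\<close>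

lemma lipschitz_envelope_tendsto:
  assumes "lower_semicontinuous_on S v" "x \<in> S"
  shows "(\<lambda>k. lipschitz_envelope S v (real k) x) \<longlonglongrightarrow> v x"
proof (rule order_tendstoI)
  fix c assume "c > v x"
  moreover have "lipschitz_envelope S v (real k) x \<le> v x" for k
    using lipschitz_envelope_le[OF assms(2), of "real k" x] by simp
  ultimately show "eventually (\<lambda>k. lipschitz_envelope S v (real k) x < c) sequentially"
    by (meson always_eventually le_less_trans)
next
  fix c assume "c < v x"
  \<comment> \<open>An infimum keeps only weak bounds, so an intermediate level is needed for the
    strict one.\<close>
  then obtain c' where c': "c < c'" "c' < v x" using dense by blast
  then obtain d where d: "d > 0" "\<And>y. y \<in> S \<Longrightarrow> y \<noteq> x \<Longrightarrow> dist y x < d \<Longrightarrow> c' < v y"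
    using assms unfolding lower_semicontinuous_on_def eventually_at by meson
  \<comment> \<open>At distance at least d, a slope of N lifts the lower bound \<open>b\<close> to
    the level c'.\<close>
  obtain N where N: "c' - b \<le> real N * d"
    using reals_Archimedean3[OF d(1)] by (meson less_imp_le)
  have "c' \<le> lipschitz_envelope S v (real k) x" if "k \<ge> N" for k
    unfolding lipschitz_envelope_def
  proof (rule cINF_greatest)
    fix y assume y: "y \<in> S"
    show "c' \<le> v y + real k * dist x y"
    proof (cases "dist x y < d")
      case True
      then have "c' < v y" using d(2)[OF y] c'(2) by (cases "y = x") (auto simp: dist_commute)
      then show ?thesis by (simp add: add_increasing2 less_imp_le)
    next
      case False
      then have "real N * d \<le> real k * dist x y" using that d(1) by (intro mult_mono) auto
      then show ?thesis using N lower[OF y] by linarith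
    qed
  qed (use assms in auto)
  then show "eventually (\<lambda>k. c < lipschitz_envelope S v (real k) x) sequentially"
    using c'(1) by (auto simp: eventually_sequentially intro: less_le_trans)
qed

end

lemma lower_semicontinuous_on_arctan:
  assumes "lower_semicontinuous_on S u"
  shows "lower_semicontinuous_on S (\<lambda>x. arctan (u x))"
  unfolding lower_semicontinuous_on_def
proof (intro ballI allI impI)
  fix x c assume x: "x \<in> S" and c: "c < arctan (u x)"
  show "eventually (\<lambda>y. c < arctan (u y)) (at x within S)"
  \<comment> \<open>Below the range of \<open>arctan\<close> the bound is automatic; otherwise c
    lies inside the range and can be pulled back by \<open>tan\<close>.\<close>
  proof (cases "- (pi / 2) < c")
    case True
    then have c2: "arctan (tan c) = c"
      using c arctan_ubound[of "u x"] by (intro arctan_tan) linarith+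
    then have "tan c < u x" using c by (metis arctan_less_iff)
    then have "eventually (\<lambda>y. tan c < u y) (at x within S)"
      using assms x unfolding lower_semicontinuous_on_def by blast
    then show ?thesis by eventually_elim (metis c2 arctan_less_iff)
  next
    case False
    then have "c < arctan (u y)" for y using arctan_lbound[of "u y"] by linarith
    then show ?thesis by simp
  qed
qed

lemma lower_semicontinuous_on_imp_baire_one_on:
  fixes S :: "'a::metric_space set"
  assumes "lower_semicontinuous_on S u"
  shows "baire_one_on S u"
\<comment> \<open>Continuity of the envelope is available only for nonempty \<open>S\<close>, where
  the infimum is meaningful.\<close>
proof (cases "S = {}")
  case True
  then show ?thesis by (simp add: baire_one_on_def)
next
  case False
  define v where "v x = arctan (u x)" for x
  have v_lower: "- (pi / 2) \<le> v y" for y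
    unfolding v_def using arctan_lbound less_imp_le by blast
  have v_lsc: "lower_semicontinuous_on S v"
    using lower_semicontinuous_on_arctan[OF assms] unfolding v_def .
  (* The envelope may attain - pi / 2, where tan is not continuous. *)
  define w where "w k x = max (lipschitz_envelope S v (real k) x) (- (pi / 2) + 1 / real (Suc k))" for k x
  have w_cont: "continuous_on S (w k)" for k
    unfolding w_def using v_lower False
    by (intro continuous_intros continuous_on_lipschitz_envelope[where b = "- (pi / 2)"]) auto
  have w_gt: "- (pi / 2) < w k x" for k x
    unfolding w_def by (simp add: less_max_iff_disj)
  have w_lt: "w k x < pi / 2" if "x \<in> S" for k x
  proof -
    have "lipschitz_envelope S v (real k) x \<le> v x"
      using lipschitz_envelope_le[of S "- (pi / 2)" v x "real k" x] v_lower that by simp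
    also have "\<dots> < pi / 2" unfolding v_def by (rule arctan_ubound)
    finally have "lipschitz_envelope S v (real k) x < pi / 2" .
    moreover have "1 / real (Suc k) \<le> 1" by simp
    then have "- (pi / 2) + 1 / real (Suc k) < pi / 2" using pi_gt3 by linarith
    ultimately show ?thesis unfolding w_def by (rule max_less_iff_conj[THEN iffD2, OF conjI])
  qed
  \<comment> \<open>The floor tends to -pi/2, which is at most \<open>v x\<close>, so the maximum
    leaves the limit unchanged.\<close>
  have w_lim: "(\<lambda>k. w k x) \<longlonglongrightarrow> v x" if "x \<in> S" for x
  proof -
    have "(\<lambda>k. - (pi / 2) + 1 / real (Suc k)) \<longlonglongrightarrow> - (pi / 2)"
      using tendsto_add[OF tendsto_const LIMSEQ_inverse_real_of_nat, of "- (pi / 2)"]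
      by (simp add: inverse_eq_divide)
    then have "(\<lambda>k. w k x) \<longlonglongrightarrow> max (v x) (- (pi / 2))"
      unfolding w_def
      by (intro tendsto_max lipschitz_envelope_tendsto[where b = "- (pi / 2)"] v_lower v_lsc that)
    then show ?thesis using v_lower by (simp add: max_absorb1)
  qed
  have "continuous_on {- (pi / 2)<..<pi / 2} tan"
    by (intro continuous_at_imp_continuous_on ballI isCont_tan) (auto dest: cos_gt_zero_pi)
  then have "continuous_on S (\<lambda>x. tan (w k x))" for k
    by (rule continuous_on_compose2[OF _ w_cont]) (use w_gt w_lt in auto)
  moreover have "(\<lambda>k. tan (w k x)) \<longlonglongrightarrow> u x" if "x \<in> S" for x
    using isCont_tendsto_compose[OF isCont_tan w_lim[OF that]] by (simp add: v_def tan_arctan)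
  ultimately show ?thesis
    unfolding baire_one_on_def by (intro exI[of _ "\<lambda>k x. tan (w k x)"]) simp
qed

lemma upper_semicontinuous_on_imp_baire_one_on:
  fixes S :: "'a::metric_space set"
  assumes "upper_semicontinuous_on S u"
  shows "baire_one_on S u"
proof -
  have "lower_semicontinuous_on S (\<lambda>x. - u x)"
    using assms unfolding upper_semicontinuous_on_def lower_semicontinuous_on_def
    \<comment> \<open>Bounds c for - u become bounds - c for u. A rewritten inequality again has the
      shape \<open>a < - b\<close>, so the remaining one is occurrence 2.\<close>
    by (subst less_minus_iff, subst (2) less_minus_iff) blast
  then show ?thesis
    using baire_one_on_minus[OF lower_semicontinuous_on_imp_baire_one_on] by fastforce
qed

section \<open>An example with both sets empty, and the theorem\<close>

lemma coordinate_grad: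
  fixes j :: "'n::finite"
  shows "grad_exists (\<lambda>x. x $ j) x" "grad (\<lambda>x. x $ j) x \<noteq> 0"
proof -
  \<comment> \<open>For h \<noteq> 0 the quotient of a coordinate function is constant: 1 if i = j,
    and 0 otherwise.\<close>
  have lim: "(partial_quotient (\<lambda>x. x $ j) i x \<longlongrightarrow> axis i 1 $ j) (at 0)" for i
    by (rule Lim_transform_eventually[OF tendsto_const])
       (auto simp: partial_quotient_def eventually_at intro!: exI[of _ 1])
  then show "grad_exists (\<lambda>x. x $ j) x"
    unfolding grad_exists_def by blast
  have "grad (\<lambda>x. x $ j) x $ j = 1"
    using tendsto_Lim[OF trivial_limit_at lim, of j] by (simp add: grad_def)
  then show "grad (\<lambda>x. x $ j) x \<noteq> 0" by auto
qed

theorem theorem2p1: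
  fixes \<Omega> :: "(real ^ 'n) set"
  assumes "open \<Omega>"
  shows "(\<forall>u. baire_one_on \<Omega> u \<longrightarrow>
            zero_grad_set \<Omega> u \<in> sets borel \<and> no_grad_set \<Omega> u \<in> sets borel)
       \<and> (\<forall>u. lower_semicontinuous_on \<Omega> u \<or> upper_semicontinuous_on \<Omega> u \<longrightarrow> baire_one_on \<Omega> u)
       \<and> (\<exists>u. baire_one_on \<Omega> u \<and> zero_grad_set \<Omega> u = {} \<and> no_grad_set \<Omega> u = {})"
proof (intro conjI)
  show "\<forall>u. baire_one_on \<Omega> u \<longrightarrow>
      zero_grad_set \<Omega> u \<in> sets borel \<and> no_grad_set \<Omega> u \<in> sets borel"
    using borel_zero_grad_set borel_no_grad_set assms by blast
  show "\<forall>u. lower_semicontinuous_on \<Omega> u \<or> upper_semicontinuous_on \<Omega> u \<longrightarrow> baire_one_on \<Omega> u"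
    using lower_semicontinuous_on_imp_baire_one_on upper_semicontinuous_on_imp_baire_one_on by blast
  \<comment> \<open>Any coordinate serves; \<open>undefined\<close> merely names some index.\<close>
  have "baire_one_on \<Omega> (\<lambda>x. x $ undefined)"
    by (intro continuous_on_imp_baire_one_on continuous_intros)
  then show "\<exists>u. baire_one_on \<Omega> u \<and> zero_grad_set \<Omega> u = {} \<and> no_grad_set \<Omega> u = {}"
    using coordinate_grad unfolding zero_grad_set_def no_grad_set_def by blast
qed

end
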